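(* If for each $j=1,\dots,\ell$ the utility function $u_j:\mathbb{R}_+^k\to\mathbb{R}$ is of the form $u_j(q_j)=f_j\big(\sum_{i=1}^k q_{ij}\big)$ for some $f_j:[0,\infty)\to\mathbb{R}$, then $\mathcal V(G)=0$ for any $G\in\Omega(\bar q)$.
   Context: Notation: $\mathbb{R}_+^k$ and $\mathbb{R}_{++}^k$ are the vectors in $\mathbb{R}^k$ with all coordinates $\ge 0$, respectively $>0$. Economy. $X\subset\mathbb{R}^m$ is compact and convex. There are $k$ goods, good $i$ being supplied at a point $x_i\in X$, and $\ell$ consumers, consumer $j$ being located at $y_j\in X$ (all these points distinct). Consumer $j$ has a utility function $u_j:\mathbb{R}_+^k\to\mathbb{R}$ that is continuous, concave and increasing ($u_j(q')>u_j(q)$ whenever $q'_i>q_i$ for all $i$), a wealth $w_j>0$ and a price vector $p_j=(p_{1j},\dots,p_{kj})\in\mathbb{R}_{++}^k$. Fix for each $j$ a maximizer $\bar q_j=(\bar q_{1j},\dots,\bar q_{kj})$ of $u_j(q_j)$ over $\{q_j\in\mathbb{R}_+^k: p_j\cdot q_j\le w_j\}$, and let $\bar q=(\bar q_{ij})_{k\times\ell}$, normalized so that $\sum_{i,j}\bar q_{ij}=1$. Put $m_i=\sum_j\bar q_{ij}$, $n_j=\sum_i\bar q_{ij}$ (all positive), $\mathbf a=\sum_i m_i\delta_{x_i}$, $\mathbf b=\sum_j n_j\delta_{y_j}$. $\mathcal P(X\times X)$ denotes probability measures $q=\sum_{i,j}q_{ij}\delta_{(x_i,y_j)}$, identified with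 nonnegative $k\times\ell$ matrices of total sum 1; $q_j=(q_{1j},\dots,q_{kj})$ is the $j$-th column. Transport paths. A transport path $G$ from $\mathbf a$ to $\mathbf b$ is a finite weighted directed graph with vertex set $V(G)\subset X$ containing all $x_i,y_j$, directed edges $e\in E(G)$ which are line segments from $e^-$ to $e^+$, and weights $w(e)>0$, such that for every vertex $v$, $\sum_{e^-=v}w(e)=\sum_{e^+=v}w(e)+c_v$, where $c_v=m_i$ if $v=x_i$, $c_v=-n_j$ if $v=y_j$, and $c_v=0$ otherwise. It is assumed that for each $(i,j)$ there is at most one directed curve $g_{ij}$ from $x_i$ to $y_j$ in $G$, i.e. at most one list of distinct vertices starting at $x_i$ and ending at $y_j$ whose consecutive members are joined by directed edges of $G$; $e\subseteq g_{ij}$ means that the edge $e$ lies on this curve. A matrix $q\in\mathcal P(X\times X)$ is compatible with $G$ if $q_{ij}=0$ whenever $g_{ij}$ does not exist and $\sum_{(i,j):e\subseteq g_{ij}}q_{ij}=w(e)$ for every $e\in E(G)$. $\Omega(\bar q)$ is the set of transport paths $G$ from $\mathbf a$ to $\mathbf b$ with which $\bar q$ is compatible. Exchange value. $S(q)=\sum_{j=1}^\ell\min\{p_j\cdot t_j: t_j\in\mathbb{R}_+^k,\ u_j(t_j)\ge u_j(q_j)\}$. For $G\in\Omega(\bar q)$, $\mathcal F_G$ is the set of $q\in\mathcal P(X\times X)$ compatible with $G$ with $u_j(q_j)\ge u_j(\bar q_j)$ for all $j$, and $\mathcal V(G)=\max_{q\in\mathcal F_G}S(q)-S(\bar q)$.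 *)

theory Defs
  imports "HOL-Analysis.Analysis"
begin

section \<open>The economy\<close>

text \<open>
  Goods are indexed by the finite type \<open>'k\<close> and consumers by the finite type \<open>'l\<close>.
  A \<open>k \<times> \<ell>\<close> matrix is a \<open>real ^ 'l ^ 'k\<close>; its \<open>j\<close>-th column, the bundle of consumer \<open>j\<close>,
  is \<^term>\<open>column j q\<close>.  Utilities are total functions, but only their values on the
  nonnegative orthant are ever constrained or used.
\<close>

definition nonneg_orthant :: "(real ^ 'k) set" where
  "nonneg_orthant = {q. \<forall>i. 0 \<le> q $ i}"

definition budget_set :: "real ^ 'k \<Rightarrow> real \<Rightarrow> (real ^ 'k) set" where
  "budget_set p w = {q \<in> nonneg_orthant. p \<bullet> q \<le> w}"

definition increasing_utility :: "(real ^ 'k \<Rightarrow> real) \<Rightarrow> bool" where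
  "increasing_utility u \<longleftrightarrow>
     (\<forall>q \<in> nonneg_orthant. \<forall>q' \<in> nonneg_orthant. (\<forall>i. q $ i < q' $ i) \<longrightarrow> u q < u q')"

text \<open>Atomic measures \<open>\<Sum>\<^sub>i\<^sub>j q\<^sub>i\<^sub>j \<delta>\<^bsub>(x\<^sub>i, y\<^sub>j)\<^esub>\<close> in \<open>\<P>(X \<times> X)\<close>, identified with their matrices.\<close>

definition prob_matrices :: "(real ^ 'l ^ 'k) set" where
  "prob_matrices = {q. (\<forall>i j. 0 \<le> q $ i $ j) \<and> (\<Sum>i\<in>UNIV. \<Sum>j\<in>UNIV. q $ i $ j) = 1}"

definition source_mass :: "real ^ 'l ^ 'k \<Rightarrow> 'k \<Rightarrow> real" where
  "source_mass q i = (\<Sum>j\<in>UNIV. q $ i $ j)"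

definition target_mass :: "real ^ 'l ^ 'k \<Rightarrow> 'l \<Rightarrow> real" where
  "target_mass q j = (\<Sum>i\<in>UNIV. q $ i $ j)"

definition economy ::
  "(real ^ 'm) set \<Rightarrow> ('k \<Rightarrow> real ^ 'm) \<Rightarrow> ('l \<Rightarrow> real ^ 'm) \<Rightarrow>
   ('l \<Rightarrow> real ^ 'k \<Rightarrow> real) \<Rightarrow> ('l \<Rightarrow> real) \<Rightarrow> ('l \<Rightarrow> real ^ 'k) \<Rightarrow> real ^ 'l ^ 'k \<Rightarrow> bool" where
  "economy X x y u w p qbar \<longleftrightarrow>
     compact X \<and> convex X \<and>
     range x \<subseteq> X \<and> range y \<subseteq> X \<and> inj x \<and> inj y \<and> range x \<inter> range y = {} \<and>
     (\<forall>j. continuous_on nonneg_orthant (u j) \<and> concave_on nonneg_orthant (u j) \<and>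
          increasing_utility (u j)) \<and>
     (\<forall>j. 0 < w j) \<and>
     (\<forall>j i. 0 < p j $ i) \<and>
     (\<forall>j. is_arg_max (u j) (\<lambda>q. q \<in> budget_set (p j) (w j)) (column j qbar)) \<and>
     (\<Sum>i\<in>UNIV. \<Sum>j\<in>UNIV. qbar $ i $ j) = 1 \<and>
     (\<forall>i. 0 < source_mass qbar i) \<and> (\<forall>j. 0 < target_mass qbar j)"


section \<open>Transport paths\<close>

text \<open>
  The line segment from \<open>v\<close> to \<open>v'\<close> is represented by the pair \<open>(v, v')\<close>.  Loops \<open>(v, v)\<close> need
  not be excluded here: they lie on no curve, so no matrix is compatible with a graph having one.
\<close>

record 'v weighted_digraph =
  verts :: "'v set"
  edges :: "('v \<times> 'v) set"
  weight :: "'v \<times> 'v \<Rightarrow> real"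

definition directed_curve :: "'v weighted_digraph \<Rightarrow> 'v \<Rightarrow> 'v \<Rightarrow> 'v list \<Rightarrow> bool" where
  "directed_curve G a b c \<longleftrightarrow>
     c \<noteq> [] \<and> set c \<subseteq> verts G \<and> distinct c \<and> hd c = a \<and> last c = b \<and>
     successively (\<lambda>v v'. (v, v') \<in> edges G) c"

definition curve_edges :: "'v list \<Rightarrow> ('v \<times> 'v) set" where
  "curve_edges c = set (zip c (tl c))"

text \<open>
  \<open>c\<^sub>v\<close>, i.e. the mass of \<open>v\<close> under \<open>a\<close> minus its mass under \<open>b\<close>.  As the points \<open>x\<^sub>i\<close> and
  \<open>y\<^sub>j\<close> are distinct, at most one summand is nonzero.
\<close>

definition net_supply ::
  "('k::finite \<Rightarrow> 'v) \<Rightarrow> ('l::finite \<Rightarrow> 'v) \<Rightarrow> ('k \<Rightarrow> real) \<Rightarrow> ('l \<Rightarrow> real) \<Rightarrow> 'v \<Rightarrow> real" where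
  "net_supply x y m n v =
     (\<Sum>i\<in>UNIV. if v = x i then m i else 0) - (\<Sum>j\<in>UNIV. if v = y j then n j else 0)"

definition transport_path ::
  "(real ^ 'm) set \<Rightarrow> ('k::finite \<Rightarrow> real ^ 'm) \<Rightarrow> ('l::finite \<Rightarrow> real ^ 'm) \<Rightarrow>
   ('k \<Rightarrow> real) \<Rightarrow> ('l \<Rightarrow> real) \<Rightarrow> (real ^ 'm) weighted_digraph \<Rightarrow> bool" where
  "transport_path X x y m n G \<longleftrightarrow>
     finite (verts G) \<and> verts G \<subseteq> X \<and> range x \<subseteq> verts G \<and> range y \<subseteq> verts G \<and>
     edges G \<subseteq> verts G \<times> verts G \<and>
     (\<forall>e \<in> edges G. 0 < weight G e) \<and>
     (\<forall>v \<in> verts G.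
        (\<Sum>e | e \<in> edges G \<and> fst e = v. weight G e) =
        (\<Sum>e | e \<in> edges G \<and> snd e = v. weight G e) + net_supply x y m n v) \<and>
     (\<forall>i j c c'. directed_curve G (x i) (y j) c \<and> directed_curve G (x i) (y j) c' \<longrightarrow> c = c')"

definition compatible ::
  "('k::finite \<Rightarrow> 'v) \<Rightarrow> ('l::finite \<Rightarrow> 'v) \<Rightarrow> 'v weighted_digraph \<Rightarrow> real ^ 'l ^ 'k \<Rightarrow> bool" where
  "compatible x y G q \<longleftrightarrow>
     q \<in> prob_matrices \<and>
     (\<forall>i j. (\<nexists>c. directed_curve G (x i) (y j) c) \<longrightarrow> q $ i $ j = 0) \<and>
     (\<forall>e \<in> edges G.
        (\<Sum>(i, j) | \<exists>c. directed_curve G (x i) (y j) c \<and> e \<in> curve_edges c. q $ i $ j)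
          = weight G e)"

definition Omega ::
  "(real ^ 'm) set \<Rightarrow> ('k::finite \<Rightarrow> real ^ 'm) \<Rightarrow> ('l::finite \<Rightarrow> real ^ 'm) \<Rightarrow> real ^ 'l ^ 'k \<Rightarrow>
   (real ^ 'm) weighted_digraph set" where
  "Omega X x y qbar =
     {G. transport_path X x y (source_mass qbar) (target_mass qbar) G \<and> compatible x y G qbar}"


section \<open>Exchange value\<close>

text \<open>
  The minimum and the maximum below are \<^const>\<open>Least\<close> and \<^const>\<open>Greatest\<close> of the set of values;
  these are meaningful only when the extremum is attained, and unspecified otherwise.
\<close>

definition min_expenditure :: "real ^ 'k \<Rightarrow> (real ^ 'k \<Rightarrow> real) \<Rightarrow> real \<Rightarrow> real" where
  "min_expenditure p u r = (LEAST v. v \<in> (\<lambda>t. p \<bullet> t) ` {t \<in> nonneg_orthant. u t \<ge> r})"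

definition S_val ::
  "('l \<Rightarrow> real ^ 'k \<Rightarrow> real) \<Rightarrow> ('l \<Rightarrow> real ^ 'k) \<Rightarrow> real ^ 'l ^ 'k \<Rightarrow> real" where
  "S_val u p q = (\<Sum>j\<in>UNIV. min_expenditure (p j) (u j) (u j (column j q)))"

definition feasible ::
  "('k::finite \<Rightarrow> 'v) \<Rightarrow> ('l::finite \<Rightarrow> 'v) \<Rightarrow> ('l \<Rightarrow> real ^ 'k \<Rightarrow> real) \<Rightarrow> real ^ 'l ^ 'k \<Rightarrow>
   'v weighted_digraph \<Rightarrow> (real ^ 'l ^ 'k) set" where
  "feasible x y u qbar G =
     {q \<in> prob_matrices. compatible x y G q \<and> (\<forall>j. u j (column j q) \<ge> u j (column j qbar))}"

definition exchange_value ::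
  "('k::finite \<Rightarrow> 'v) \<Rightarrow> ('l::finite \<Rightarrow> 'v) \<Rightarrow> ('l \<Rightarrow> real ^ 'k \<Rightarrow> real) \<Rightarrow> ('l \<Rightarrow> real ^ 'k) \<Rightarrow>
   real ^ 'l ^ 'k \<Rightarrow> 'v weighted_digraph \<Rightarrow> real" where
  "exchange_value x y u p qbar G =
     (GREATEST v. v \<in> S_val u p ` feasible x y u qbar G) - S_val u p qbar"

text \<open>
  Under the standing assumptions the minimum in \<^const>\<open>min_expenditure\<close> is attained at every
  utility level that \<^const>\<open>S_val\<close> refers to.
\<close>

lemma min_expenditure_attained:
  fixes u :: "real ^ 'k \<Rightarrow> real" and p q :: "real ^ 'k"
  assumes cont: "continuous_on nonneg_orthant u"
    and pos: "\<And>i. 0 < p $ i"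
    and q: "q \<in> nonneg_orthant"
  obtains t where "t \<in> nonneg_orthant" "u t \<ge> u q" "min_expenditure p u (u q) = p \<bullet> t"
    "\<And>s. s \<in> nonneg_orthant \<Longrightarrow> u s \<ge> u q \<Longrightarrow> p \<bullet> t \<le> p \<bullet> s"
proof -
  define K where "K = {t \<in> nonneg_orthant. u t \<ge> u q \<and> p \<bullet> t \<le> p \<bullet> q}"
  have orth: "nonneg_orthant = (\<Inter>i. {t :: real ^ 'k. 0 \<le> t $ i})"
    by (auto simp: nonneg_orthant_def)
  have clorth: "closed (nonneg_orthant :: (real ^ 'k) set)"
    unfolding orth
    by (rule closed_INT, rule ballI, rule closed_Collect_le) (intro continuous_intros)+
  have "closed (nonneg_orthant \<inter> u -` {u q..})"
    by (rule continuous_closed_preimage[OF cont clorth]) simp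
  moreover have "closed {t. p \<bullet> t \<le> p \<bullet> q}"
    by (rule closed_halfspace_le)
  moreover have "K = (nonneg_orthant \<inter> u -` {u q..}) \<inter> {t. p \<bullet> t \<le> p \<bullet> q}"
    by (auto simp: K_def)
  ultimately have clK: "closed K" by (simp add: closed_Int)
  have "K \<subseteq> cbox 0 (\<chi> i. (p \<bullet> q) / p $ i)"
  proof
    fix t assume t: "t \<in> K"
    have nn: "0 \<le> t $ i" for i using t by (auto simp: K_def nonneg_orthant_def)
    have "t $ i \<le> (p \<bullet> q) / p $ i" for i
    proof -
      have "p $ i * t $ i \<le> (\<Sum>i\<in>UNIV. p $ i * t $ i)"
        by (rule member_le_sum) (auto intro!: mult_nonneg_nonneg nn less_imp_le[OF pos])
      also have "\<dots> \<le> p \<bullet> q" using t by (simp add: K_def inner_vec_def)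
      finally show ?thesis using pos[of i] by (simp add: field_simps)
    qed
    with nn show "t \<in> cbox 0 (\<chi> i. (p \<bullet> q) / p $ i)" by (simp add: mem_box_cart)
  qed
  then have cK: "compact K"
    using clK bounded_cbox bounded_subset compact_eq_bounded_closed by blast
  have neK: "K \<noteq> {}" using q by (auto simp: K_def)
  have coK: "continuous_on K (\<lambda>t. p \<bullet> t)" by (intro continuous_intros)
  obtain t where t: "t \<in> K" "\<And>s. s \<in> K \<Longrightarrow> p \<bullet> t \<le> p \<bullet> s"
    using continuous_attains_inf[OF cK neK coK] by auto
  have le: "p \<bullet> t \<le> p \<bullet> s" if "s \<in> nonneg_orthant" "u s \<ge> u q" for s
  proof (cases "p \<bullet> s \<le> p \<bullet> q")
    case True
    then show ?thesis using t(2) that by (auto simp: K_def)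
  next
    case False
    then show ?thesis using t(1) by (auto simp: K_def)
  qed
  have mem: "t \<in> nonneg_orthant" "u t \<ge> u q" using t(1) by (auto simp: K_def)
  have "min_expenditure p u (u q) = p \<bullet> t"
    unfolding min_expenditure_def using le mem by (intro Least_equality) auto
  then show thesis using that[OF mem] le by metis
qed

end

theory Submission
  imports Defs
begin

text \<open>
  Since \<open>u\<^sub>j\<close> depends only on the total consumption of consumer \<open>j\<close>, monotonicity along constant
  bundles forces every feasible \<open>q\<close> to give each consumer at least the total mass that \<open>qbar\<close>
  gives.  Both matrices have total mass 1, so these totals, hence all utility levels, agree, and
  \<open>S\<close> is constant on the feasible set.
\<close>

text \<open>\<open>increasing_utility\<close> compares only bundles that differ strictly in every
  coordinate, so the two totals have to be realized by such a pair.\<close>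

lemma increasing_utility_of_sum_strict_mono:
  fixes u :: "real ^ 'k::finite \<Rightarrow> real"
  assumes inc: "increasing_utility u"
    and u: "\<And>q. q \<in> nonneg_orthant \<Longrightarrow> u q = f (\<Sum>i\<in>UNIV. q $ i)"
    and "0 \<le> s" "s < t"
  shows "f s < f t"
proof -
  \<comment> \<open>Equal shares: the coordinates of \<open>c r\<close> add up to \<open>r\<close>,
    and each of them grows strictly with \<open>r\<close>.\<close>
  define c where "c r = (\<chi> i::'k. r / real CARD('k))" for r
  have c: "c r \<in> nonneg_orthant" if "0 \<le> r" for r
    using that by (simp add: c_def nonneg_orthant_def)
  have uc: "u (c r) = f r" if "0 \<le> r" for r
    using u[OF c[OF that]] by (simp add: c_def)
  have "c s $ i < c t $ i" for i
    using \<open>s < t\<close> by (simp add: c_def divide_strict_right_mono)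
  then have "u (c s) < u (c t)"
    using inc c assms(3,4) unfolding increasing_utility_def by auto
  then show ?thesis using uc assms(3,4) by simp
qed

lemma column_nonneg_orthant:
  assumes "q \<in> prob_matrices"
  shows "column j q \<in> nonneg_orthant"
  using assms by (simp add: prob_matrices_def nonneg_orthant_def column_def)

lemma sum_target_mass:
  assumes "q \<in> prob_matrices"
  shows "(\<Sum>j\<in>UNIV. target_mass q j) = 1"
  using assms sum.swap[of "\<lambda>i j. q $ i $ j" UNIV UNIV]
  by (simp add: prob_matrices_def target_mass_def)

lemma target_mass_eq_if_weakly_preferred:
  fixes q q' :: "real ^ 'l::finite ^ 'k::finite"
  assumes inc: "\<And>j. increasing_utility (u j)"
    and u: "\<And>j q. q \<in> nonneg_orthant \<Longrightarrow> u j q = f j (\<Sum>i\<in>UNIV. q $ i)"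
    and q: "q \<in> prob_matrices" and q': "q' \<in> prob_matrices"
    and pref: "\<And>j. u j (column j q) \<ge> u j (column j q')"
  shows "target_mass q j = target_mass q' j"
proof -
  have uval: "u j (column j r) = f j (target_mass r j)" if "r \<in> prob_matrices" for r j
    using u[OF column_nonneg_orthant[OF that]] by (simp add: column_def target_mass_def)
  have le: "target_mass q' j \<le> target_mass q j" for j
  proof (rule ccontr)
    assume "\<not> target_mass q' j \<le> target_mass q j"
    \<comment> \<open>The utility determines \<open>f j\<close> only at nonnegative totals, so
      strict monotonicity is available only from such a total upwards.\<close>
    moreover have "0 \<le> target_mass q j"
      using q by (auto simp: prob_matrices_def target_mass_def intro: sum_nonneg)
    ultimately have "f j (target_mass q j) < f j (target_mass q' j)"
      using increasing_utility_of_sum_strict_mono[OF inc u] by auto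
    then show False using pref[of j] uval q q' by simp
  qed
  \<comment> \<open>By \<open>le\<close> these differences are nonnegative, so a zero sum makes each
    of them vanish.\<close>
  have "(\<Sum>j\<in>UNIV. target_mass q j - target_mass q' j) = 0"
    by (simp add: sum_subtractf sum_target_mass q q')
  then have "\<forall>j\<in>UNIV. target_mass q j - target_mass q' j = 0"
    using le by (subst (asm) sum_nonneg_eq_0_iff) auto
  then show ?thesis by simp
qed

theorem proposition3p5:
  fixes X :: "(real ^ 'm) set"
    and x :: "'k::finite \<Rightarrow> real ^ 'm" and y :: "'l::finite \<Rightarrow> real ^ 'm"
    and u :: "'l \<Rightarrow> real ^ 'k \<Rightarrow> real" and w :: "'l \<Rightarrow> real" and p :: "'l \<Rightarrow> real ^ 'k"
    and qbar :: "real ^ 'l ^ 'k"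
  assumes "economy X x y u w p qbar"
    and "\<forall>j. \<exists>f :: real \<Rightarrow> real. \<forall>q \<in> nonneg_orthant. u j q = f (\<Sum>i\<in>UNIV. q $ i)"
  shows "\<forall>G \<in> Omega X x y qbar. exchange_value x y u p qbar G = 0"
proof
  fix G assume "G \<in> Omega X x y qbar"
  then have comp: "compatible x y G qbar" by (simp add: Omega_def)
  then have qbar: "qbar \<in> prob_matrices" by (simp add: compatible_def)
  have inc: "increasing_utility (u j)" for j
    using assms(1) by (simp add: economy_def)
  obtain f where f: "\<And>j q. q \<in> nonneg_orthant \<Longrightarrow> u j q = f j (\<Sum>i\<in>UNIV. q $ i)"
    using choice[OF assms(2)] by blast
  \<comment> \<open>\<open>S_val\<close> sees a matrix only through the utility levels of its
    columns, so equal levels suffice.\<close>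
  have "S_val u p q = S_val u p qbar" if "q \<in> feasible x y u qbar G" for q
  proof -
    have q: "q \<in> prob_matrices" and pref: "u j (column j q) \<ge> u j (column j qbar)" for j
      using that by (auto simp: feasible_def)
    have "u j (column j q) = u j (column j qbar)" for j
      using target_mass_eq_if_weakly_preferred[OF inc f q qbar pref, of j]
        f[OF column_nonneg_orthant[OF q], of j j] f[OF column_nonneg_orthant[OF qbar], of j j]
      by (simp add: column_def target_mass_def)
    then show ?thesis by (simp add: S_val_def)
  qed
  \<comment> \<open>This makes the feasible set nonempty, so the set of values is a singleton and
    \<open>GREATEST\<close> really is its maximum.\<close>
  moreover have "qbar \<in> feasible x y u qbar G"
    using qbar comp by (simp add: feasible_def)
  ultimately have "S_val u p ` feasible x y u qbar G = {S_val u p qbar}"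
    by blast
  then show "exchange_value x y u p qbar G = 0"
    by (simp add: exchange_value_def Greatest_equality)
qed

end
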